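(* Let $R$ be an associative ring with identity and $M$ a right $R$-module. The following conditions are equivalent: (1) $M$ is SIP. (2) For any two direct summands $A_1$ and $A_2$ of $M$ with $A_1\simeq A_2$, $A_1\cap A_2$ is a direct summand of $M$.
   Context: A module $M$ is SIP if the intersection of any two direct summands of $M$ is a direct summand of $M$. *)

theory Defs
  imports "HOL-Algebra.Algebra"
begin

text \<open>
  The library locale for modules requires a commutative ring of scalars. For right modules over an
  arbitrary ring with identity we reuse the library record of modules and its submodule locale
  (whose axioms do not depend on the side), reading \<open>a \<odot>\<^bsub>M\<^esub> x\<close> as the right action \<open>x \<cdot> a\<close>.
  Thus the associativity law \<open>x \<cdot> (a b) = (x \<cdot> a) \<cdot> b\<close> appears with the factors reversed.
\<close>

locale right_module = R?: ring R + M?: abelian_group M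
  for R :: "('a, 'r) ring_scheme" (structure) and M :: "('a, 'b, 'm) module_scheme" (structure) +
  assumes smult_closed:
      "\<lbrakk>a \<in> carrier R; x \<in> carrier M\<rbrakk> \<Longrightarrow> a \<odot>\<^bsub>M\<^esub> x \<in> carrier M"
    and smult_l_distr:
      "\<lbrakk>a \<in> carrier R; b \<in> carrier R; x \<in> carrier M\<rbrakk> \<Longrightarrow>
        (a \<oplus>\<^bsub>R\<^esub> b) \<odot>\<^bsub>M\<^esub> x = a \<odot>\<^bsub>M\<^esub> x \<oplus>\<^bsub>M\<^esub> b \<odot>\<^bsub>M\<^esub> x"
    and smult_r_distr:
      "\<lbrakk>a \<in> carrier R; x \<in> carrier M; y \<in> carrier M\<rbrakk> \<Longrightarrow>
        a \<odot>\<^bsub>M\<^esub> (x \<oplus>\<^bsub>M\<^esub> y) = a \<odot>\<^bsub>M\<^esub> x \<oplus>\<^bsub>M\<^esub> a \<odot>\<^bsub>M\<^esub> y"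
    and smult_assoc:
      "\<lbrakk>a \<in> carrier R; b \<in> carrier R; x \<in> carrier M\<rbrakk> \<Longrightarrow>
        (a \<otimes>\<^bsub>R\<^esub> b) \<odot>\<^bsub>M\<^esub> x = b \<odot>\<^bsub>M\<^esub> (a \<odot>\<^bsub>M\<^esub> x)"
    and smult_one:
      "x \<in> carrier M \<Longrightarrow> \<one>\<^bsub>R\<^esub> \<odot>\<^bsub>M\<^esub> x = x"

definition module_iso ::
  "('a, 'r) ring_scheme \<Rightarrow> ('a, 'b, 'm) module_scheme \<Rightarrow> ('a, 'c, 'n) module_scheme \<Rightarrow> ('b \<Rightarrow> 'c) set"
  where "module_iso R M N =
    {f \<in> iso (add_monoid M) (add_monoid N).
      \<forall>a\<in>carrier R. \<forall>x\<in>carrier M. f (a \<odot>\<^bsub>M\<^esub> x) = a \<odot>\<^bsub>N\<^esub> f x}"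

definition submodules_isomorphic ::
  "('a, 'r) ring_scheme \<Rightarrow> ('a, 'b, 'm) module_scheme \<Rightarrow> 'b set \<Rightarrow> 'b set \<Rightarrow> bool"
  where "submodules_isomorphic R M A B \<longleftrightarrow>
    module_iso R (M\<lparr>carrier := A\<rparr>) (M\<lparr>carrier := B\<rparr>) \<noteq> {}"

definition direct_summand ::
  "('a, 'r) ring_scheme \<Rightarrow> ('a, 'b, 'm) module_scheme \<Rightarrow> 'b set \<Rightarrow> bool"
  where "direct_summand R M A \<longleftrightarrow>
    submodule A R M \<and>
    (\<exists>B. submodule B R M \<and> A <+>\<^bsub>M\<^esub> B = carrier M \<and> A \<inter> B = {\<zero>\<^bsub>M\<^esub>})"

definition SIP :: "('a, 'r) ring_scheme \<Rightarrow> ('a, 'b, 'm) module_scheme \<Rightarrow> bool"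
  where "SIP R M \<longleftrightarrow>
    (\<forall>A B. direct_summand R M A \<longrightarrow> direct_summand R M B \<longrightarrow> direct_summand R M (A \<inter> B))"

end

theory Submission
  imports Defs
begin

text \<open>
  Let \<open>M = A \<oplus> A' = B \<oplus> B'\<close>, let \<open>p\<close> be the projection onto \<open>A'\<close> along \<open>A\<close> and \<open>f\<close> the
  projection onto \<open>B\<close> along \<open>B'\<close>, and let \<open>h : A \<rightarrow> A'\<close> be the restriction of \<open>p f\<close>. The graph
  \<open>{x + h x | x \<in> A}\<close> is isomorphic to \<open>A\<close>, is again a complement of \<open>A'\<close>, and meets \<open>A\<close> in
  \<open>ker h\<close>; so \<open>ker h\<close> is a direct summand. As \<open>ker h\<close> consists of the \<open>x \<in> A\<close> with \<open>f x \<in> A\<close>,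
  splitting \<open>x = f x + (x - f x)\<close> shows \<open>ker h = (A \<inter> B) \<oplus> (A \<inter> B')\<close>, of which \<open>A \<inter> B\<close> is
  a direct summand.
\<close>

text \<open>Only the two equations are recorded. Where the values lie is supplied separately, so the
  same predicate serves for a projection on all of \<open>M\<close> and for a map from a summand
  into its complement.\<close>

definition linear_on ::
  "('a, 'r) ring_scheme \<Rightarrow> ('a, 'b, 'm) module_scheme \<Rightarrow> 'b set \<Rightarrow> ('b \<Rightarrow> 'b) \<Rightarrow> bool"
  where "linear_on R M A h \<longleftrightarrow>
    (\<forall>x\<in>A. \<forall>y\<in>A. h (x \<oplus>\<^bsub>M\<^esub> y) = h x \<oplus>\<^bsub>M\<^esub> h y) \<and>
    (\<forall>r\<in>carrier R. \<forall>x\<in>A. h (r \<odot>\<^bsub>M\<^esub> x) = r \<odot>\<^bsub>M\<^esub> h x)"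

text \<open>Keeps the complement visible, because projections and graphs depend on which complement
  is chosen.\<close>

definition direct_decomp ::
  "('a, 'r) ring_scheme \<Rightarrow> ('a, 'b, 'm) module_scheme \<Rightarrow> 'b set \<Rightarrow> 'b set \<Rightarrow> bool"
  where "direct_decomp R M A B \<longleftrightarrow> submodule A R M \<and> submodule B R M \<and>
    A <+>\<^bsub>M\<^esub> B = carrier M \<and> A \<inter> B = {\<zero>\<^bsub>M\<^esub>}"

lemma direct_summand_iff: "direct_summand R M A \<longleftrightarrow> (\<exists>B. direct_decomp R M A B)"
  by (auto simp: direct_summand_def direct_decomp_def)

lemma mem_set_add_iff: "x \<in> A <+>\<^bsub>M\<^esub> B \<longleftrightarrow> (\<exists>a\<in>A. \<exists>b\<in>B. x = a \<oplus>\<^bsub>M\<^esub> b)"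
  by (auto simp: set_add_def set_mult_def)

context right_module
begin

section \<open>Arithmetic of submodules\<close>

lemma set_add_commute:
  "A \<subseteq> carrier M \<Longrightarrow> B \<subseteq> carrier M \<Longrightarrow> A <+>\<^bsub>M\<^esub> B = B <+>\<^bsub>M\<^esub> A"
  unfolding set_add_def set_mult_def
  by (auto simp: subset_iff) (blast intro: M.a_comm)+

lemma add_minus_cancel:
  "x \<in> carrier M \<Longrightarrow> y \<in> carrier M \<Longrightarrow> x \<oplus>\<^bsub>M\<^esub> (y \<ominus>\<^bsub>M\<^esub> x) = y"
  by (simp add: M.minus_eq M.a_comm[of y] M.r_neg2)

lemma
  assumes "submodule A R M"
  shows submodule_subset: "A \<subseteq> carrier M"
    and submodule_zero: "\<zero>\<^bsub>M\<^esub> \<in> A"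
    and submodule_add: "\<And>x y. x \<in> A \<Longrightarrow> y \<in> A \<Longrightarrow> x \<oplus>\<^bsub>M\<^esub> y \<in> A"
    and submodule_neg: "\<And>x. x \<in> A \<Longrightarrow> \<ominus>\<^bsub>M\<^esub> x \<in> A"
    and submodule_smult: "\<And>r x. r \<in> carrier R \<Longrightarrow> x \<in> A \<Longrightarrow> r \<odot>\<^bsub>M\<^esub> x \<in> A"
proof -
  interpret A: submodule A R M by fact
  show "A \<subseteq> carrier M" "\<zero>\<^bsub>M\<^esub> \<in> A"
    "\<And>x y. x \<in> A \<Longrightarrow> y \<in> A \<Longrightarrow> x \<oplus>\<^bsub>M\<^esub> y \<in> A"
    "\<And>x. x \<in> A \<Longrightarrow> \<ominus>\<^bsub>M\<^esub> x \<in> A"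
    "\<And>r x. r \<in> carrier R \<Longrightarrow> x \<in> A \<Longrightarrow> r \<odot>\<^bsub>M\<^esub> x \<in> A"
    using A.subset A.one_closed A.m_closed A.m_inv_closed A.smult_closed
    by (auto simp: a_inv_def)
qed

text \<open>Negatives come for free, since \<open>-x\<close> is the scalar multiple of
  \<open>x\<close> by \<open>-1\<close>.\<close>

lemma submoduleI:
  assumes "A \<subseteq> carrier M" "\<zero>\<^bsub>M\<^esub> \<in> A"
    and "\<And>x y. x \<in> A \<Longrightarrow> y \<in> A \<Longrightarrow> x \<oplus>\<^bsub>M\<^esub> y \<in> A"
    and "\<And>r x. r \<in> carrier R \<Longrightarrow> x \<in> A \<Longrightarrow> r \<odot>\<^bsub>M\<^esub> x \<in> A"
  shows "submodule A R M"
proof -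
  have neg: "\<ominus>\<^bsub>M\<^esub> x = (\<ominus>\<^bsub>R\<^esub> \<one>\<^bsub>R\<^esub>) \<odot>\<^bsub>M\<^esub> x" if "x \<in> carrier M" for x
  proof -
    have z: "\<zero>\<^bsub>R\<^esub> \<odot>\<^bsub>M\<^esub> x = \<zero>\<^bsub>M\<^esub>"
      using smult_l_distr[of "\<zero>\<^bsub>R\<^esub>" "\<zero>\<^bsub>R\<^esub>" x] smult_closed[of "\<zero>\<^bsub>R\<^esub>" x] that
      by (metis M.add.r_cancel_one' R.l_zero R.zero_closed)
    have "(\<ominus>\<^bsub>R\<^esub> \<one>\<^bsub>R\<^esub>) \<odot>\<^bsub>M\<^esub> x \<oplus>\<^bsub>M\<^esub> x = \<zero>\<^bsub>M\<^esub>"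
      using smult_l_distr[of "\<ominus>\<^bsub>R\<^esub> \<one>\<^bsub>R\<^esub>" "\<one>\<^bsub>R\<^esub>" x] z that by (simp add: R.l_neg smult_one)
    then show ?thesis
      using that by (intro M.minus_equality) (auto intro: smult_closed)
  qed
  \<comment> \<open>\<open>submodule\<close> contains the subgroup axioms of
    \<open>add_monoid M\<close>; folding \<open>a_inv_def\<close> turns the group inverse into the
    additive one, which \<open>neg\<close> then rewrites as a scalar multiple.\<close>
  show ?thesis
    using assms
    by unfold_locales (auto simp: subset_iff neg simp flip: a_inv_def)
qed

lemma submodule_Int: "submodule A R M \<Longrightarrow> submodule B R M \<Longrightarrow> submodule (A \<inter> B) R M"
  using submodule_subset submodule_zero submodule_add submodule_smult
  by (intro submoduleI) (auto simp: subset_iff)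

lemma submodule_set_add:
  assumes A: "submodule A R M" and B: "submodule B R M"
  shows "submodule (A <+>\<^bsub>M\<^esub> B) R M"
proof (rule submoduleI)
  note sub [simp] = subsetD[OF submodule_subset[OF A]] subsetD[OF submodule_subset[OF B]]
  show "A <+>\<^bsub>M\<^esub> B \<subseteq> carrier M" by (auto simp: mem_set_add_iff)
  show "\<zero>\<^bsub>M\<^esub> \<in> A <+>\<^bsub>M\<^esub> B"
    using submodule_zero[OF A] submodule_zero[OF B] by (force simp: mem_set_add_iff)
  show "x \<oplus>\<^bsub>M\<^esub> y \<in> A <+>\<^bsub>M\<^esub> B" if xy: "x \<in> A <+>\<^bsub>M\<^esub> B" "y \<in> A <+>\<^bsub>M\<^esub> B" for x y
  proof -
    obtain a b a' b' where m: "a \<in> A" "b \<in> B" "a' \<in> A" "b' \<in> B"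
      and x: "x = a \<oplus>\<^bsub>M\<^esub> b" and y: "y = a' \<oplus>\<^bsub>M\<^esub> b'"
      using xy by (auto simp: mem_set_add_iff)
    have "x \<oplus>\<^bsub>M\<^esub> y = (a \<oplus>\<^bsub>M\<^esub> a') \<oplus>\<^bsub>M\<^esub> (b \<oplus>\<^bsub>M\<^esub> b')"
      using m by (simp add: x y M.a_ac)
    then show ?thesis
      using m submodule_add[OF A] submodule_add[OF B] unfolding mem_set_add_iff by blast
  qed
  show "r \<odot>\<^bsub>M\<^esub> x \<in> A <+>\<^bsub>M\<^esub> B" if "r \<in> carrier R" "x \<in> A <+>\<^bsub>M\<^esub> B" for r x
    using that submodule_smult[OF A] submodule_smult[OF B]
    unfolding mem_set_add_iff by (metis smult_r_distr sub)
qed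

section \<open>Unique decompositions and projections\<close>

text \<open>The difference \<open>a - a'\<close> equals \<open>b' - b\<close>, so it lies in both
  summands and vanishes.\<close>

lemma direct_decomp_unique:
  assumes d: "direct_decomp R M A B"
    and m: "a \<in> A" "a' \<in> A" "b \<in> B" "b' \<in> B" and eq: "a \<oplus>\<^bsub>M\<^esub> b = a' \<oplus>\<^bsub>M\<^esub> b'"
  shows "a = a'"
proof -
  have A: "submodule A R M" and B: "submodule B R M" and I: "A \<inter> B = {\<zero>\<^bsub>M\<^esub>}"
    using d by (auto simp: direct_decomp_def)
  note sub [simp] = subsetD[OF submodule_subset[OF A]] subsetD[OF submodule_subset[OF B]]
  have c [simp]: "a \<in> carrier M" "a' \<in> carrier M" "b \<in> carrier M" "b' \<in> carrier M" using m by auto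
  \<comment> \<open>Adding and subtracting \<open>b\<close> makes \<open>a + b\<close> appear as a
    block, so that \<open>eq\<close> can be substituted.\<close>
  have "a \<ominus>\<^bsub>M\<^esub> a' = (a \<oplus>\<^bsub>M\<^esub> b) \<oplus>\<^bsub>M\<^esub> (\<ominus>\<^bsub>M\<^esub> a' \<oplus>\<^bsub>M\<^esub> \<ominus>\<^bsub>M\<^esub> b)"
    by (simp add: M.minus_eq M.a_ac M.r_neg M.r_neg1)
  also have "\<dots> = (a' \<oplus>\<^bsub>M\<^esub> \<ominus>\<^bsub>M\<^esub> a') \<oplus>\<^bsub>M\<^esub> (b' \<oplus>\<^bsub>M\<^esub> \<ominus>\<^bsub>M\<^esub> b)"
    unfolding eq by (simp add: M.a_ac)
  also have "\<dots> = b' \<ominus>\<^bsub>M\<^esub> b"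
    by (simp add: M.minus_eq M.r_neg)
  finally have e: "a \<ominus>\<^bsub>M\<^esub> a' = b' \<ominus>\<^bsub>M\<^esub> b" .
  have "a \<ominus>\<^bsub>M\<^esub> a' \<in> A" "b' \<ominus>\<^bsub>M\<^esub> b \<in> B"
    using m submodule_add submodule_neg A B by (auto simp: M.minus_eq)
  then have "a \<ominus>\<^bsub>M\<^esub> a' = \<zero>\<^bsub>M\<^esub>" using e I by auto
  then show ?thesis
    using add_minus_cancel[of a' a] by simp
qed

text \<open>Components are picked by choice; uniqueness of the decomposition forces the chosen
  function to be linear.\<close>

lemma direct_decomp_projection:
  assumes d: "direct_decomp R M A B"
  obtains e where "linear_on R M (carrier M) e"
    and "\<And>x. x \<in> carrier M \<Longrightarrow> e x \<in> A"
    and "\<And>x. x \<in> carrier M \<Longrightarrow> x \<ominus>\<^bsub>M\<^esub> e x \<in> B"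
    and "\<And>x. x \<in> carrier M \<Longrightarrow> e x = x \<longleftrightarrow> x \<in> A"
    and "\<And>x. x \<in> carrier M \<Longrightarrow> e x = \<zero>\<^bsub>M\<^esub> \<longleftrightarrow> x \<in> B"
proof -
  have A: "submodule A R M" and B: "submodule B R M" and S: "A <+>\<^bsub>M\<^esub> B = carrier M"
    using d by (auto simp: direct_decomp_def)
  note sub [simp] = subsetD[OF submodule_subset[OF A]] subsetD[OF submodule_subset[OF B]]
  note cl = submodule_zero[OF A] submodule_zero[OF B] submodule_add[OF A] submodule_add[OF B]
    submodule_smult[OF A] submodule_smult[OF B]
  have "\<forall>x\<in>carrier M. \<exists>a\<in>A. \<exists>b\<in>B. x = a \<oplus>\<^bsub>M\<^esub> b"
    unfolding S[symmetric] by (auto simp: mem_set_add_iff)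
  then obtain e g where eA: "\<And>x. x \<in> carrier M \<Longrightarrow> e x \<in> A"
    and gB: "\<And>x. x \<in> carrier M \<Longrightarrow> g x \<in> B"
    and eg: "\<And>x. x \<in> carrier M \<Longrightarrow> x = e x \<oplus>\<^bsub>M\<^esub> g x"
    by metis
  \<comment> \<open>Evaluates \<open>e\<close> on any explicit splitting, so each property below
    only needs a suitable splitting of its argument.\<close>
  have uniq: "e (a \<oplus>\<^bsub>M\<^esub> b) = a" if "a \<in> A" "b \<in> B" for a b
    using that eg[of "a \<oplus>\<^bsub>M\<^esub> b"]
    by (intro direct_decomp_unique[OF d eA _ gB[of "a \<oplus>\<^bsub>M\<^esub> b"]]) auto
  have "e (x \<oplus>\<^bsub>M\<^esub> y) = e x \<oplus>\<^bsub>M\<^esub> e y" if xy: "x \<in> carrier M" "y \<in> carrier M" for x y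
  proof -
    have "x \<oplus>\<^bsub>M\<^esub> y = (e x \<oplus>\<^bsub>M\<^esub> g x) \<oplus>\<^bsub>M\<^esub> (e y \<oplus>\<^bsub>M\<^esub> g y)" using eg xy by simp
    also have "\<dots> = (e x \<oplus>\<^bsub>M\<^esub> e y) \<oplus>\<^bsub>M\<^esub> (g x \<oplus>\<^bsub>M\<^esub> g y)"
      using eA gB xy by (simp add: M.a_ac)
    finally show ?thesis using uniq eA gB xy cl by simp
  qed
  moreover have "e (r \<odot>\<^bsub>M\<^esub> x) = r \<odot>\<^bsub>M\<^esub> e x" if rx: "r \<in> carrier R" "x \<in> carrier M" for r x
  proof -
    have "r \<odot>\<^bsub>M\<^esub> x = r \<odot>\<^bsub>M\<^esub> (e x \<oplus>\<^bsub>M\<^esub> g x)" using eg rx by simp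
    also have "\<dots> = r \<odot>\<^bsub>M\<^esub> e x \<oplus>\<^bsub>M\<^esub> r \<odot>\<^bsub>M\<^esub> g x"
      using eA gB rx by (simp add: smult_r_distr)
    finally show ?thesis using uniq eA gB rx cl by simp
  qed
  ultimately have "linear_on R M (carrier M) e" by (simp add: linear_on_def)
  moreover have "x \<ominus>\<^bsub>M\<^esub> e x = g x" if "x \<in> carrier M" for x
  proof -
    have "e x \<oplus>\<^bsub>M\<^esub> (x \<ominus>\<^bsub>M\<^esub> e x) = e x \<oplus>\<^bsub>M\<^esub> g x"
      using eA that by (simp add: add_minus_cancel flip: eg)
    then show ?thesis using eA gB that M.add.l_cancel by simp
  qed
  \<comment> \<open>The splittings \<open>x + 0\<close> for \<open>x\<close> in \<open>A\<close>
    and, next, \<open>0 + x\<close> for \<open>x\<close> in \<open>B\<close> determine fixed points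
    and kernel.\<close>
  moreover have "e x = x \<longleftrightarrow> x \<in> A" if "x \<in> carrier M" for x
    using uniq[of x "\<zero>\<^bsub>M\<^esub>"] eA[OF that] cl that by auto
  moreover have "e x = \<zero>\<^bsub>M\<^esub> \<longleftrightarrow> x \<in> B" if "x \<in> carrier M" for x
    using uniq[of "\<zero>\<^bsub>M\<^esub>" x] eg[OF that] gB[OF that] cl that by auto
  ultimately show thesis using that[of e] eA gB by simp
qed

section \<open>Graphs of linear maps between complements\<close>

text \<open>Modulo \<open>B\<close> the map \<open>x + h x\<close> is the identity on
  \<open>A\<close>. Hence it is injective, and its image \<open>G\<close> can replace
  \<open>A\<close> as a complement of \<open>B\<close>.\<close>

lemma graph_direct_decomp:
  assumes d: "direct_decomp R M A B"
    and h: "linear_on R M A h" and hAB: "h ` A \<subseteq> B"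
  defines "G \<equiv> (\<lambda>x. x \<oplus>\<^bsub>M\<^esub> h x) ` A"
  shows "direct_decomp R M G B"
    and "submodules_isomorphic R M A G"
    and "A \<inter> G = {x \<in> A. h x = \<zero>\<^bsub>M\<^esub>}"
proof -
  have hB: "\<And>x. x \<in> A \<Longrightarrow> h x \<in> B" using hAB by blast
  have A: "submodule A R M" and B: "submodule B R M" and S: "A <+>\<^bsub>M\<^esub> B = carrier M"
    and I: "A \<inter> B = {\<zero>\<^bsub>M\<^esub>}"
    using d by (auto simp: direct_decomp_def)
  note sub [simp] = subsetD[OF submodule_subset[OF A]] subsetD[OF submodule_subset[OF B]]
  note cl = submodule_zero[OF A] submodule_zero[OF B] submodule_add[OF A] submodule_add[OF B]
    submodule_smult[OF A] submodule_smult[OF B] submodule_neg[OF A] submodule_neg[OF B]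
  have add: "(x \<oplus>\<^bsub>M\<^esub> y) \<oplus>\<^bsub>M\<^esub> h (x \<oplus>\<^bsub>M\<^esub> y) = (x \<oplus>\<^bsub>M\<^esub> h x) \<oplus>\<^bsub>M\<^esub> (y \<oplus>\<^bsub>M\<^esub> h y)"
    if "x \<in> A" "y \<in> A" for x y
    using h that hB by (simp add: linear_on_def M.a_ac)
  have smult: "r \<odot>\<^bsub>M\<^esub> x \<oplus>\<^bsub>M\<^esub> h (r \<odot>\<^bsub>M\<^esub> x) = r \<odot>\<^bsub>M\<^esub> (x \<oplus>\<^bsub>M\<^esub> h x)"
    if "r \<in> carrier R" "x \<in> A" for r x
    using h that hB by (simp add: linear_on_def smult_r_distr)
  have h0: "h \<zero>\<^bsub>M\<^esub> = \<zero>\<^bsub>M\<^esub>"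
  proof -
    have "h \<zero>\<^bsub>M\<^esub> \<oplus>\<^bsub>M\<^esub> h \<zero>\<^bsub>M\<^esub> = h (\<zero>\<^bsub>M\<^esub> \<oplus>\<^bsub>M\<^esub> \<zero>\<^bsub>M\<^esub>)"
      using h cl unfolding linear_on_def by metis
    moreover have "h \<zero>\<^bsub>M\<^esub> \<in> carrier M" using hB cl by simp
    ultimately show ?thesis by simp
  qed
  \<comment> \<open>A graph element has \<open>A\<close>-component \<open>x\<close>. This yields the
    trivial intersection with \<open>B\<close>, injectivity, and the description of
    \<open>A \<inter> G\<close>.\<close>
  have uniq: "x = a" if "x \<in> A" "a \<in> A" "b \<in> B" "x \<oplus>\<^bsub>M\<^esub> h x = a \<oplus>\<^bsub>M\<^esub> b" for x a b
    using direct_decomp_unique[OF d] that hB by blast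
  have G: "submodule G R M"
  proof (rule submoduleI)
    show "G \<subseteq> carrier M" using hB by (auto simp: G_def)
    show "\<zero>\<^bsub>M\<^esub> \<in> G" using h0 cl by (force simp: G_def)
    show "x \<oplus>\<^bsub>M\<^esub> y \<in> G" if "x \<in> G" "y \<in> G" for x y
      using that add cl unfolding G_def by (auto simp flip: add)
    show "r \<odot>\<^bsub>M\<^esub> x \<in> G" if "r \<in> carrier R" "x \<in> G" for r x
      using that smult cl unfolding G_def by (auto simp flip: smult)
  qed
  have "G <+>\<^bsub>M\<^esub> B = carrier M"
  proof
    show "G <+>\<^bsub>M\<^esub> B \<subseteq> carrier M" using submodule_set_add[OF G B] submodule_subset by blast
    show "carrier M \<subseteq> G <+>\<^bsub>M\<^esub> B"
    proof
      fix x assume "x \<in> carrier M"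
      then obtain a b where ab: "a \<in> A" "b \<in> B" "x = a \<oplus>\<^bsub>M\<^esub> b"
        unfolding S[symmetric] by (auto simp: mem_set_add_iff)
      \<comment> \<open>The \<open>A\<close>-component stays \<open>a\<close>; the added
        \<open>h a\<close> is compensated inside \<open>B\<close>.\<close>
      then have "x = (a \<oplus>\<^bsub>M\<^esub> h a) \<oplus>\<^bsub>M\<^esub> (b \<ominus>\<^bsub>M\<^esub> h a)"
        using hB by (simp add: M.a_assoc add_minus_cancel)
      moreover have "b \<ominus>\<^bsub>M\<^esub> h a \<in> B" using ab hB cl by (simp add: M.minus_eq)
      ultimately show "x \<in> G <+>\<^bsub>M\<^esub> B" using ab unfolding mem_set_add_iff G_def by blast
    qed
  qed
  moreover have "G \<inter> B = {\<zero>\<^bsub>M\<^esub>}"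
  proof -
    have "x \<oplus>\<^bsub>M\<^esub> h x = \<zero>\<^bsub>M\<^esub>" if "x \<in> A" "x \<oplus>\<^bsub>M\<^esub> h x \<in> B" for x
      \<comment> \<open>An element of \<open>B\<close> has \<open>A\<close>-component zero, so
        \<open>x = 0\<close>, and then \<open>h x = 0\<close> by \<open>h0\<close>.\<close>
      using uniq[of x "\<zero>\<^bsub>M\<^esub>" "x \<oplus>\<^bsub>M\<^esub> h x"] that cl h0 by simp
    then have "G \<inter> B \<subseteq> {\<zero>\<^bsub>M\<^esub>}" unfolding G_def by blast
    then show ?thesis using submodule_zero[OF G] cl by blast
  qed
  ultimately show "direct_decomp R M G B" using G B by (simp add: direct_decomp_def)
  have "inj_on (\<lambda>x. x \<oplus>\<^bsub>M\<^esub> h x) A" using uniq hB by (auto intro!: inj_onI)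
  then have "(\<lambda>x. x \<oplus>\<^bsub>M\<^esub> h x) \<in> module_iso R (M\<lparr>carrier := A\<rparr>) (M\<lparr>carrier := G\<rparr>)"
    using add smult by (auto simp: module_iso_def iso_def hom_def bij_betw_def G_def)
  then show "submodules_isomorphic R M A G" by (auto simp: submodules_isomorphic_def)
  show "A \<inter> G = {x \<in> A. h x = \<zero>\<^bsub>M\<^esub>}"
  proof (intro equalityI subsetI)
    fix x assume "x \<in> A \<inter> G"
    then obtain y where x: "x \<in> A" and y: "y \<in> A" and xy: "x = y \<oplus>\<^bsub>M\<^esub> h y"
      by (auto simp: G_def)
    \<comment> \<open>Since \<open>x\<close> lies in \<open>A\<close>, its splitting is
      \<open>x + 0\<close>; comparing components gives \<open>y = x\<close> and then
      \<open>h x = 0\<close>.\<close>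
    have "y \<oplus>\<^bsub>M\<^esub> h y = x \<oplus>\<^bsub>M\<^esub> \<zero>\<^bsub>M\<^esub>" unfolding xy[symmetric] using x by simp
    then have "y = x" using uniq x y cl(2) by blast
    then have "x \<oplus>\<^bsub>M\<^esub> h x = x \<oplus>\<^bsub>M\<^esub> \<zero>\<^bsub>M\<^esub>" using xy x by simp
    then have "h x = \<zero>\<^bsub>M\<^esub>" using M.add.l_cancel[of x "h x" "\<zero>\<^bsub>M\<^esub>"] x hB by simp
    then show "x \<in> {x \<in> A. h x = \<zero>\<^bsub>M\<^esub>}" using x by simp
  next
    fix x assume "x \<in> {x \<in> A. h x = \<zero>\<^bsub>M\<^esub>}"
    then show "x \<in> A \<inter> G" unfolding G_def by (auto intro!: image_eqI[of _ _ x])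
  qed
qed

section \<open>From isomorphic summands to arbitrary ones\<close>

text \<open>If \<open>C\<close> is a complement of \<open>P + Q\<close>, then \<open>Q + C\<close>
  is a complement of \<open>P\<close>.\<close>

lemma direct_summand_set_addD:
  assumes K: "direct_summand R M (P <+>\<^bsub>M\<^esub> Q)"
    and P: "submodule P R M" and Q: "submodule Q R M" and I: "P \<inter> Q = {\<zero>\<^bsub>M\<^esub>}"
  shows "direct_summand R M P"
proof -
  obtain C where d: "direct_decomp R M (P <+>\<^bsub>M\<^esub> Q) C"
    using K by (auto simp: direct_summand_iff)
  then have C: "submodule C R M" and S: "(P <+>\<^bsub>M\<^esub> Q) <+>\<^bsub>M\<^esub> C = carrier M"
    by (auto simp: direct_decomp_def)
  note sub [simp] = subsetD[OF submodule_subset[OF P]] subsetD[OF submodule_subset[OF Q]]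
    subsetD[OF submodule_subset[OF C]]
  have "P <+>\<^bsub>M\<^esub> (Q <+>\<^bsub>M\<^esub> C) = carrier M"
    using S submodule_subset[OF P] submodule_subset[OF Q] submodule_subset[OF C]
    by (simp add: set_add_def M.add.set_mult_assoc)
  moreover have "P \<inter> (Q <+>\<^bsub>M\<^esub> C) = {\<zero>\<^bsub>M\<^esub>}"
  proof -
    have "p = \<zero>\<^bsub>M\<^esub>" if m: "p \<in> P" "q \<in> Q" "c \<in> C" "p = q \<oplus>\<^bsub>M\<^esub> c" for p q c
    proof -
      \<comment> \<open>Both \<open>p\<close> and \<open>q\<close> lie in \<open>P + Q\<close>, so
        \<open>p + 0 = q + c\<close> consists of two splittings along \<open>C\<close>. Thus
        \<open>p = q\<close>, an element of \<open>P \<inter> Q\<close>.\<close>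
      have "p \<in> P <+>\<^bsub>M\<^esub> Q" "q \<in> P <+>\<^bsub>M\<^esub> Q"
        using m submodule_zero[OF P] submodule_zero[OF Q] M.l_zero M.r_zero sub
        unfolding mem_set_add_iff by metis+
      then have "p = q"
        using direct_decomp_unique[OF d, of p q "\<zero>\<^bsub>M\<^esub>" c] m submodule_zero[OF C] by simp
      then show ?thesis using I m by auto
    qed
    then have "P \<inter> (Q <+>\<^bsub>M\<^esub> C) \<subseteq> {\<zero>\<^bsub>M\<^esub>}" by (auto simp only: mem_set_add_iff)
    then show ?thesis
      using submodule_zero[OF P] submodule_zero[OF submodule_set_add[OF Q C]] by blast
  qed
  ultimately show ?thesis
    using P submodule_set_add[OF Q C] unfolding direct_summand_def by blast
qed

text \<open>The hypothesis \<open>iso\<close> is applied just once, to \<open>A\<close> and the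
  graph of \<open>h\<close>, and not to \<open>A\<close> and \<open>B\<close> themselves.\<close>

lemma direct_summand_Int_if_isomorphic:
  assumes iso: "\<And>A B. direct_summand R M A \<Longrightarrow> direct_summand R M B \<Longrightarrow>
      submodules_isomorphic R M A B \<Longrightarrow> direct_summand R M (A \<inter> B)"
    and "direct_summand R M A" and "direct_summand R M B"
  shows "direct_summand R M (A \<inter> B)"
proof -
  obtain A' B' where dA: "direct_decomp R M A A'" and dB: "direct_decomp R M B B'"
    using assms by (auto simp: direct_summand_iff)
  have A: "submodule A R M" and A': "submodule A' R M"
    and B: "submodule B R M" and B': "submodule B' R M" and I: "B \<inter> B' = {\<zero>\<^bsub>M\<^esub>}"
    using dA dB by (auto simp: direct_decomp_def)
  note sub [simp] = subsetD[OF submodule_subset[OF A]] subsetD[OF submodule_subset[OF A']]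
    subsetD[OF submodule_subset[OF B]] subsetD[OF submodule_subset[OF B']]
  \<comment> \<open>The decomposition is swapped so that the projection \<open>p\<close> lands in
    \<open>A'\<close> and has kernel \<open>A\<close>.\<close>
  have dA': "direct_decomp R M A' A"
    using dA set_add_commute[OF submodule_subset[OF A] submodule_subset[OF A']]
    by (auto simp: direct_decomp_def)
  obtain p where p: "linear_on R M (carrier M) p" "\<And>x. x \<in> carrier M \<Longrightarrow> p x \<in> A'"
    and p0: "\<And>x. x \<in> carrier M \<Longrightarrow> p x = \<zero>\<^bsub>M\<^esub> \<longleftrightarrow> x \<in> A"
    using direct_decomp_projection[OF dA'] by metis
  obtain f where f: "linear_on R M (carrier M) f" "\<And>x. x \<in> carrier M \<Longrightarrow> f x \<in> B"
    and fB': "\<And>x. x \<in> carrier M \<Longrightarrow> x \<ominus>\<^bsub>M\<^esub> f x \<in> B'"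
    and f1: "\<And>x. x \<in> carrier M \<Longrightarrow> f x = x \<longleftrightarrow> x \<in> B"
    and f0: "\<And>x. x \<in> carrier M \<Longrightarrow> f x = \<zero>\<^bsub>M\<^esub> \<longleftrightarrow> x \<in> B'"
    by (rule direct_decomp_projection[OF dB]) (rule that)
  define h where "h = p \<circ> f"
  have h: "linear_on R M A h" "h ` A \<subseteq> A'"
    using p f by (auto simp: linear_on_def h_def)
  note graph = graph_direct_decomp[OF dA h]
  \<comment> \<open>The graph is a direct summand because \<open>A'\<close> is still a complement of
    it, and its intersection with \<open>A\<close> is the kernel of \<open>h\<close>.\<close>
  have "direct_summand R M {x \<in> A. h x = \<zero>\<^bsub>M\<^esub>}"
    using iso[OF assms(2) _ graph(2)] graph(1) by (auto simp: direct_summand_iff graph(3))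
  \<comment> \<open>As \<open>p\<close> has kernel \<open>A\<close>, \<open>p (f x) = 0\<close>
    means exactly that \<open>f x\<close> lies in \<open>A\<close>.\<close>
  also have "{x \<in> A. h x = \<zero>\<^bsub>M\<^esub>} = {x \<in> A. f x \<in> A}"
    using p0 f by (auto simp: h_def)
  also have "\<dots> = (A \<inter> B) <+>\<^bsub>M\<^esub> (A \<inter> B')"
  proof safe
    fix x assume x: "x \<in> A" "f x \<in> A"
    have "x = f x \<oplus>\<^bsub>M\<^esub> (x \<ominus>\<^bsub>M\<^esub> f x)"
      using x by (simp add: add_minus_cancel)
    moreover have "x \<ominus>\<^bsub>M\<^esub> f x \<in> A"
      using x submodule_add[OF A] submodule_neg[OF A] by (simp add: M.minus_eq)
    ultimately show "x \<in> (A \<inter> B) <+>\<^bsub>M\<^esub> (A \<inter> B')"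
      using x f(2) fB' sub(1) unfolding mem_set_add_iff by (metis IntI)
  next
    fix x assume "x \<in> (A \<inter> B) <+>\<^bsub>M\<^esub> (A \<inter> B')"
    then obtain b b' where bb: "b \<in> A" "b \<in> B" "b' \<in> A" "b' \<in> B'" "x = b \<oplus>\<^bsub>M\<^esub> b'"
      by (auto simp: mem_set_add_iff)
    then show "x \<in> A" using submodule_add[OF A] by simp
    \<comment> \<open>The projection \<open>f\<close> fixes the \<open>B\<close>-part and kills the
      \<open>B'\<close>-part, so \<open>f x\<close> is \<open>b\<close>, which lies in
      \<open>A\<close>.\<close>
    have "f b = b" "f b' = \<zero>\<^bsub>M\<^esub>" using f1 f0 bb by auto
    then show "f x \<in> A" using f(1) bb by (simp add: linear_on_def)
  qed
  \<comment> \<open>The two pieces meet only in zero because \<open>B\<close> and \<open>B'\<close>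
    do, so the first piece is itself a direct summand.\<close>
  finally show ?thesis
    by (rule direct_summand_set_addD)
      (use submodule_zero[OF A] I in \<open>auto intro: submodule_Int A B B'\<close>)
qed

end

theorem corollary2p5:
  fixes R :: "('a, 'r) ring_scheme" and M :: "('a, 'b, 'm) module_scheme"
  assumes "right_module R M"
  shows "SIP R M \<longleftrightarrow>
    (\<forall>A\<^sub>1 A\<^sub>2. direct_summand R M A\<^sub>1 \<longrightarrow> direct_summand R M A\<^sub>2 \<longrightarrow>
      submodules_isomorphic R M A\<^sub>1 A\<^sub>2 \<longrightarrow> direct_summand R M (A\<^sub>1 \<inter> A\<^sub>2))"
  \<comment> \<open>The forward direction merely restricts \<open>SIP\<close> to isomorphic pairs;
    the lemma supplies the converse.\<close>
  using right_module.direct_summand_Int_if_isomorphic[OF assms] unfolding SIP_def by blast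

end
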